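(* Let $H$ be an affine algebraic group acting regularly on an irreducible affine variety $X$ over an algebraically closed field $\Bbbk$, and suppose that ${}^H\Bbbk[X]$ is a finitely generated $\Bbbk$--algebra. Let $\pi:X\to X/_{\mathrm{aff}}H$ be the affinized quotient. If every fiber of $\pi$ is a single (closed) $H$--orbit, then the action of $H$ on $X$ is observable.
   Context: $H$ acts on $\Bbbk[X]$ by $(x\cdot f)(p)=f(x^{-1}p)$ (any convention for the induced action gives the same invariants); ${}^H\Bbbk[X]$ is the algebra of $H$--invariant regular functions. When it is finitely generated, $X/_{\mathrm{aff}}H$ is the affine variety with coordinate ring ${}^H\Bbbk[X]$ and $\pi$ is the morphism corresponding to the inclusion ${}^H\Bbbk[X]\subseteq\Bbbk[X]$. The action of $H$ on $X$ is observable if for every $H$--stable closed subset $Y\subsetneq X$ there exists a nonzero $f\in{}^H\Bbbk[X]$ vanishing on $Y$. *)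

theory Defs
  imports "HOL-Computational_Algebra.Polynomial" "HOL-Algebra.Group"
begin

definition alg_closed :: "'k::field itself \<Rightarrow> bool" where
  "alg_closed _ \<longleftrightarrow> (\<forall>p::'k poly. degree p > 0 \<longrightarrow> (\<exists>x. poly p x = 0))"

text \<open>Polynomial functions on the affine space of points 'i => 'k
  (for finite 'i this is k^n; the coordinate ring k[x_i]).\<close>
inductive_set polyfun :: "(('i \<Rightarrow> 'k::comm_ring_1) \<Rightarrow> 'k) set" where
  pf_const: "(\<lambda>x. c) \<in> polyfun"
| pf_var: "(\<lambda>x. x i) \<in> polyfun"
| pf_add: "p \<in> polyfun \<Longrightarrow> q \<in> polyfun \<Longrightarrow> (\<lambda>x. p x + q x) \<in> polyfun"
| pf_mult: "p \<in> polyfun \<Longrightarrow> q \<in> polyfun \<Longrightarrow> (\<lambda>x. p x * q x) \<in> polyfun"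

definition poly_map :: "(('i \<Rightarrow> 'k::comm_ring_1) \<Rightarrow> ('j \<Rightarrow> 'k)) \<Rightarrow> bool" where
  "poly_map \<phi> \<longleftrightarrow> (\<forall>j. (\<lambda>x. \<phi> x j) \<in> polyfun)"

definition zariski_closed :: "('i \<Rightarrow> 'k::comm_ring_1) set \<Rightarrow> bool" where
  "zariski_closed S \<longleftrightarrow> (\<exists>F \<subseteq> polyfun. S = {x. \<forall>f\<in>F. f x = 0})"

definition zclosure :: "('i \<Rightarrow> 'k::comm_ring_1) set \<Rightarrow> ('i \<Rightarrow> 'k) set" where
  "zclosure S = \<Inter>{C. zariski_closed C \<and> S \<subseteq> C}"

definition irreducible_variety :: "('i \<Rightarrow> 'k::comm_ring_1) set \<Rightarrow> bool" where
  "irreducible_variety X \<longleftrightarrow> zariski_closed X \<and> X \<noteq> {} \<and>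
     (\<forall>A B. zariski_closed A \<and> zariski_closed B \<and> X \<subseteq> A \<union> B \<longrightarrow> X \<subseteq> A \<or> X \<subseteq> B)"

definition regular_on :: "('i \<Rightarrow> 'k::comm_ring_1) set \<Rightarrow> (('i \<Rightarrow> 'k) \<Rightarrow> 'k) \<Rightarrow> bool" where
  "regular_on X f \<longleftrightarrow> (\<exists>p\<in>polyfun. \<forall>x\<in>X. f x = p x)"

definition affine_alg_group :: "('m \<Rightarrow> 'k::comm_ring_1) monoid \<Rightarrow> bool" where
  "affine_alg_group G \<longleftrightarrow> group G \<and> zariski_closed (carrier G) \<and>
     (\<exists>\<mu>::(('m + 'm) \<Rightarrow> 'k) \<Rightarrow> ('m \<Rightarrow> 'k). poly_map \<mu> \<and>
        (\<forall>g\<in>carrier G. \<forall>h\<in>carrier G. \<mu> (case_sum g h) = g \<otimes>\<^bsub>G\<^esub> h)) \<and>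
     (\<exists>\<iota>::('m \<Rightarrow> 'k) \<Rightarrow> ('m \<Rightarrow> 'k). poly_map \<iota> \<and>
        (\<forall>g\<in>carrier G. \<iota> g = inv\<^bsub>G\<^esub> g))"

definition regular_action ::
  "('m \<Rightarrow> 'k::comm_ring_1) monoid \<Rightarrow> ('n \<Rightarrow> 'k) set \<Rightarrow> (('m \<Rightarrow> 'k) \<Rightarrow> ('n \<Rightarrow> 'k) \<Rightarrow> ('n \<Rightarrow> 'k)) \<Rightarrow> bool" where
  "regular_action G X act \<longleftrightarrow>
     (\<exists>\<alpha>::(('m + 'n) \<Rightarrow> 'k) \<Rightarrow> ('n \<Rightarrow> 'k). poly_map \<alpha> \<and>
        (\<forall>g\<in>carrier G. \<forall>x\<in>X. act g x = \<alpha> (case_sum g x))) \<and>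
     (\<forall>g\<in>carrier G. \<forall>x\<in>X. act g x \<in> X) \<and>
     (\<forall>x\<in>X. act \<one>\<^bsub>G\<^esub> x = x) \<and>
     (\<forall>g\<in>carrier G. \<forall>h\<in>carrier G. \<forall>x\<in>X. act (g \<otimes>\<^bsub>G\<^esub> h) x = act g (act h x))"

definition invariant_fun where
  "invariant_fun G X act f \<longleftrightarrow> regular_on X f \<and>
     (\<forall>g\<in>carrier G. \<forall>x\<in>X. f (act (inv\<^bsub>G\<^esub> g) x) = f x)"

definition orbit where
  "orbit G act x = {act g x | g. g \<in> carrier G}"

definition gen_map :: "(('n \<Rightarrow> 'k) \<Rightarrow> 'k) list \<Rightarrow> ('n \<Rightarrow> 'k) \<Rightarrow> (nat \<Rightarrow> 'k::comm_ring_1)" where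
  "gen_map fs x = (\<lambda>i. if i < length fs then (fs ! i) x else 0)"

definition generates_invariants where
  "generates_invariants G X act fs \<longleftrightarrow>
     (\<forall>f\<in>set fs. invariant_fun G X act f) \<and>
     (\<forall>f. invariant_fun G X act f \<longrightarrow>
        (\<exists>P\<in>(polyfun :: ((nat \<Rightarrow> 'k::comm_ring_1) \<Rightarrow> 'k) set). \<forall>x\<in>X. f x = P (gen_map fs x)))"

text \<open>X/_aff H realised via generators fs: the affine variety with coordinate ring
  k[f_1..f_r] = ^H k[X], i.e. the Zariski closure of the image of pi = gen_map fs.\<close>
definition aff_quotient where
  "aff_quotient X fs = zclosure (gen_map fs ` X)"

definition observable_action where
  "observable_action G X act \<longleftrightarrow>
     (\<forall>Y. zariski_closed Y \<and> Y \<subseteq> X \<and> Y \<noteq> X \<and> (\<forall>g\<in>carrier G. \<forall>y\<in>Y. act g y \<in> Y) \<longrightarrow>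
        (\<exists>f. invariant_fun G X act f \<and> (\<exists>x\<in>X. f x \<noteq> 0) \<and> (\<forall>y\<in>Y. f y = 0)))"

end

theory Submission
  imports Defs "HOL-Library.Function_Algebras"
begin

text \<open>Let g be a regular function vanishing on the stable closed set Y but not on X. Since the
  coordinate ring of X is a domain obtained from the ring of invariants by adjoining finitely many
  elements, some nonzero invariant a has the property that every homomorphism from the invariants
  to k that does not kill a extends to the coordinate ring without killing g (Atiyah--Macdonald,
  Proposition 5.23, one generator at a time). If a did not vanish at some y in Y, extending the
  evaluation at y would give a point x of X with g x nonzero in the same fibre, hence in the same
  orbit, as y; but then x lies in Y, where g vanishes. So a vanishes on Y.\<close>

section \<open>Subrings, homomorphisms defined on them, and polynomials with coefficients in
  them\<close>

definition unital_subring :: "'a::comm_ring_1 set \<Rightarrow> bool" where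
  "unital_subring R \<longleftrightarrow> 1 \<in> R \<and> (\<forall>a\<in>R. - a \<in> R) \<and> (\<forall>a\<in>R. \<forall>b\<in>R. a + b \<in> R \<and> a * b \<in> R)"

text \<open>Homomorphisms are total functions constrained only on \<open>R\<close>, so that
  extending one means agreeing with it on \<open>R\<close>. Compatibility with \<open>0\<close>
  follows from additivity.\<close>

definition ring_hom_on :: "'a::comm_ring_1 set \<Rightarrow> ('a \<Rightarrow> 'b::comm_ring_1) \<Rightarrow> bool" where
  "ring_hom_on R \<phi> \<longleftrightarrow>
     \<phi> 1 = 1 \<and> (\<forall>a\<in>R. \<forall>b\<in>R. \<phi> (a + b) = \<phi> a + \<phi> b \<and> \<phi> (a * b) = \<phi> a * \<phi> b)"

text \<open>Stated for a subset because the ambient type will be the ring of all functions on affine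
  space, which has zero divisors, while the coordinate ring inside it is a domain.\<close>

definition no_zero_divisors_on :: "'a::comm_ring_1 set \<Rightarrow> bool" where
  "no_zero_divisors_on R \<longleftrightarrow> (\<forall>a\<in>R. \<forall>b\<in>R. a * b = 0 \<longrightarrow> a = 0 \<or> b = 0)"

definition polys_over :: "'a::comm_ring_1 set \<Rightarrow> 'a poly set" where
  "polys_over R = {p. \<forall>i. coeff p i \<in> R}"

text \<open>This is the subring \<open>R[x]\<close> of the ambient ring, as the image of evaluation
  at \<open>x\<close>.\<close>

definition adjoin :: "'a::comm_ring_1 set \<Rightarrow> 'a \<Rightarrow> 'a set" where
  "adjoin R x = (\<lambda>p. poly p x) ` polys_over R"

lemma unital_subringD:
  assumes "unital_subring R"
  shows "1 \<in> R" "0 \<in> R" "a \<in> R \<Longrightarrow> - a \<in> R" "a \<in> R \<Longrightarrow> b \<in> R \<Longrightarrow> a + b \<in> R"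
    "a \<in> R \<Longrightarrow> b \<in> R \<Longrightarrow> a - b \<in> R" "a \<in> R \<Longrightarrow> b \<in> R \<Longrightarrow> a * b \<in> R"
    "a \<in> R \<Longrightarrow> a ^ n \<in> R"
proof -
  show 1: "1 \<in> R" and neg: "a \<in> R \<Longrightarrow> - a \<in> R" for a
    using assms by (auto simp: unital_subring_def)
  show add: "a \<in> R \<Longrightarrow> b \<in> R \<Longrightarrow> a + b \<in> R" and mult: "a \<in> R \<Longrightarrow> b \<in> R \<Longrightarrow> a * b \<in> R" for a b
    using assms by (auto simp: unital_subring_def)
  show "0 \<in> R"
    using add[OF 1 neg[OF 1]] by simp
  show "a \<in> R \<Longrightarrow> b \<in> R \<Longrightarrow> a - b \<in> R"
    using add[OF _ neg, of a b] by simp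
  show "a \<in> R \<Longrightarrow> a ^ n \<in> R"
    by (induction n) (auto simp: 1 mult)
qed

lemma unital_subring_sum:
  assumes "unital_subring R" "\<And>i. i \<in> I \<Longrightarrow> f i \<in> R"
  shows "sum f I \<in> R"
  using assms(2)
  by (induction I rule: infinite_finite_induct) (auto simp: unital_subringD[OF assms(1)])

lemma ring_hom_onD:
  assumes "unital_subring R" "ring_hom_on R \<phi>"
  shows "\<phi> 1 = 1" "\<phi> 0 = 0" "a \<in> R \<Longrightarrow> b \<in> R \<Longrightarrow> \<phi> (a + b) = \<phi> a + \<phi> b"
    "a \<in> R \<Longrightarrow> b \<in> R \<Longrightarrow> \<phi> (a * b) = \<phi> a * \<phi> b" "a \<in> R \<Longrightarrow> \<phi> (a ^ n) = \<phi> a ^ n"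
proof -
  note R = unital_subringD[OF assms(1)]
  show 1: "\<phi> 1 = 1" and add: "a \<in> R \<Longrightarrow> b \<in> R \<Longrightarrow> \<phi> (a + b) = \<phi> a + \<phi> b"
    and mult: "a \<in> R \<Longrightarrow> b \<in> R \<Longrightarrow> \<phi> (a * b) = \<phi> a * \<phi> b" for a b
    using assms(2) by (auto simp: ring_hom_on_def)
  show "\<phi> 0 = 0"
    using add[OF R(2) R(2)] by simp
  show "a \<in> R \<Longrightarrow> \<phi> (a ^ n) = \<phi> a ^ n"
    by (induction n) (auto simp: 1 mult R)
qed

lemma ring_hom_on_sum:
  assumes "unital_subring R" "ring_hom_on R \<phi>" "\<And>i. i \<in> I \<Longrightarrow> f i \<in> R"
  shows "\<phi> (sum f I) = (\<Sum>i\<in>I. \<phi> (f i))"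
  using assms(3)
  by (induction I rule: infinite_finite_induct)
    (auto simp: ring_hom_onD[OF assms(1,2)] unital_subring_sum[OF assms(1)])

lemma polys_overD: "p \<in> polys_over R \<Longrightarrow> coeff p i \<in> R"
  by (simp add: polys_over_def)

lemma polys_over_closed:
  assumes "unital_subring R"
  shows "0 \<in> polys_over R" "1 \<in> polys_over R" "c \<in> R \<Longrightarrow> [:c:] \<in> polys_over R"
    "c \<in> R \<Longrightarrow> monom c n \<in> polys_over R"
    "p \<in> polys_over R \<Longrightarrow> - p \<in> polys_over R"
    "p \<in> polys_over R \<Longrightarrow> q \<in> polys_over R \<Longrightarrow> p + q \<in> polys_over R"
    "p \<in> polys_over R \<Longrightarrow> q \<in> polys_over R \<Longrightarrow> p - q \<in> polys_over R"
    "p \<in> polys_over R \<Longrightarrow> q \<in> polys_over R \<Longrightarrow> p * q \<in> polys_over R"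
    "c \<in> R \<Longrightarrow> p \<in> polys_over R \<Longrightarrow> smult c p \<in> polys_over R"
  using unital_subringD[OF assms]
  by (auto simp: polys_over_def coeff_mult coeff_pCons intro!: unital_subring_sum[OF assms]
      split: nat.split)

text \<open>All coefficients, their products and the sums of these stay in \<open>R\<close>, where
  \<open>\<phi>\<close> respects the operations.\<close>

lemma map_poly_ring_hom_on:
  assumes R: "unital_subring R" and \<phi>: "ring_hom_on R \<phi>"
    and p: "p \<in> polys_over R" and q: "q \<in> polys_over R"
  shows "map_poly \<phi> (p + q) = map_poly \<phi> p + map_poly \<phi> q"
    "map_poly \<phi> (p * q) = map_poly \<phi> p * map_poly \<phi> q"
    "c \<in> R \<Longrightarrow> map_poly \<phi> (smult c p) = smult (\<phi> c) (map_poly \<phi> p)"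
proof -
  note h = ring_hom_onD[OF R \<phi>] and pq = polys_overD[OF p] polys_overD[OF q]
  show "map_poly \<phi> (p + q) = map_poly \<phi> p + map_poly \<phi> q"
    "c \<in> R \<Longrightarrow> map_poly \<phi> (smult c p) = smult (\<phi> c) (map_poly \<phi> p)"
    by (auto intro!: poly_eqI simp: coeff_map_poly h pq)
  show "map_poly \<phi> (p * q) = map_poly \<phi> p * map_poly \<phi> q"
    by (intro poly_eqI)
      (simp add: coeff_map_poly h pq coeff_mult ring_hom_on_sum[OF R \<phi>] unital_subringD[OF R])
qed

lemma unital_subring_adjoin:
  assumes "unital_subring R"
  shows "unital_subring (adjoin R x)" "R \<subseteq> adjoin R x" "x \<in> adjoin R x"
proof -
  note cl = polys_over_closed[OF assms]
  have "1 \<in> adjoin R x"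
    unfolding adjoin_def by (rule image_eqI[OF _ cl(2)]) simp
  moreover have "- a \<in> adjoin R x" if "a \<in> adjoin R x" for a
    using that cl(5) unfolding adjoin_def by (force simp flip: poly_minus)
  moreover have "a + b \<in> adjoin R x \<and> a * b \<in> adjoin R x"
    if "a \<in> adjoin R x" "b \<in> adjoin R x" for a b
    using that cl(6,8) unfolding adjoin_def by (force simp flip: poly_add poly_mult)
  ultimately show "unital_subring (adjoin R x)"
    by (auto simp: unital_subring_def)
  show "R \<subseteq> adjoin R x"
  proof
    fix c assume "c \<in> R"
    then show "c \<in> adjoin R x"
      unfolding adjoin_def by (intro image_eqI[OF _ cl(3)[of c]]) auto
  qed
  show "x \<in> adjoin R x"
    unfolding adjoin_def
    by (rule image_eqI[OF _ cl(4)[of 1 1]]) (auto simp: poly_monom unital_subringD[OF assms])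
qed

section \<open>Pseudo-division and homomorphisms out of \<open>R[x]\<close>\<close>

text \<open>Long division without inverses: multiplying by the leading coefficient of
  \<open>g\<close> before each subtraction keeps everything over \<open>R\<close>, at the price of
  the power \<open>N\<close>.\<close>

lemma pseudo_division_over:
  assumes R: "unital_subring R" and f: "f \<in> polys_over R" and g: "g \<in> polys_over R" "g \<noteq> 0"
  obtains N h r where "h \<in> polys_over R" "r \<in> polys_over R"
    "smult (lead_coeff g ^ N) f = g * h + r" "r = 0 \<or> degree r < degree g"
proof -
  define c where "c = lead_coeff g"
  have c: "c \<in> R"
    using g polys_overD c_def by blast
  \<comment> \<open>The induction runs on a bound \<open>n\<close> from which all coefficients
    vanish, rather than on the degree, so the zero polynomial needs no separate treatment.\<close>
  have "\<exists>N h r. h \<in> polys_over R \<and> r \<in> polys_over R \<and> smult (c ^ N) f = g * h + r \<and>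
      (r = 0 \<or> degree r < degree g)"
    if "f \<in> polys_over R" "\<forall>i\<ge>n. coeff f i = 0" for n f
    using that
  proof (induction n arbitrary: f)
    case 0
    then have "f = 0"
      by (auto intro: poly_eqI)
    then show ?case
      using polys_over_closed(1)[OF R] by (intro exI[of _ 0]) simp
  next
    case (Suc n)
    show ?case
    proof (cases "n < degree g")
      case True
      have "degree f \<le> n"
        using Suc.prems(2) by (intro degree_le) auto
      then have "degree f < degree g"
        using True by simp
      then show ?thesis
        using Suc.prems(1) polys_over_closed(1)[OF R]
        by (intro exI[of _ 0] exI[of _ f]) simp
    next
      case False
      \<comment> \<open>\<open>m\<close> is chosen so that the coefficients of
        \<open>smult c f\<close> and \<open>m * g\<close> at index \<open>n\<close> cancel, which
        lowers the bound to \<open>n\<close>.\<close>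
      define m where "m = monom (coeff f n) (n - degree g)"
      define f' where "f' = smult c f - m * g"
      have m: "m \<in> polys_over R"
        unfolding m_def by (intro polys_over_closed[OF R] polys_overD Suc.prems)
      have f': "f' \<in> polys_over R"
        unfolding f'_def by (intro polys_over_closed[OF R] c m g Suc.prems)
      have "coeff f' i = 0" if "i \<ge> n" for i
      proof (cases "i = n")
        case True
        then show ?thesis
          using False by (simp add: f'_def m_def coeff_monom_mult c_def)
      next
        case False
        then have "coeff f i = 0" "i - (n - degree g) > degree g"
          using Suc.prems(2) that \<open>\<not> n < degree g\<close> by auto
        then show ?thesis
          by (simp add: f'_def m_def coeff_monom_mult coeff_eq_0)
      qed
      then obtain N h r where *: "h \<in> polys_over R" "r \<in> polys_over R"
        "smult (c ^ N) f' = g * h + r" "r = 0 \<or> degree r < degree g"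
        using Suc.IH[OF f'] by blast
      have "smult (c ^ Suc N) f = smult (c ^ N) (f' + m * g)"
        by (simp add: f'_def mult.commute)
      also have "\<dots> = g * (h + smult (c ^ N) m) + r"
        by (simp add: smult_add_right *(3) algebra_simps)
      finally have "smult (c ^ Suc N) f = g * (h + smult (c ^ N) m) + r" .
      moreover have "h + smult (c ^ N) m \<in> polys_over R"
        using * m c by (intro polys_over_closed[OF R] unital_subringD[OF R])
      ultimately show ?thesis
        using *(2,4) by blast
    qed
  qed
  from this[OF f, of "Suc (degree f)"] show ?thesis
    using that by (auto simp: c_def coeff_eq_0)
qed

text \<open>Sending \<open>x\<close> to \<open>t\<close> is well defined as soon as \<open>t\<close>
  satisfies the image under \<open>\<phi>\<close> of every relation that \<open>x\<close> satisfies
  over \<open>R\<close>.\<close>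

lemma ring_hom_on_adjoin:
  assumes R: "unital_subring R" and \<phi>: "ring_hom_on R \<phi>"
    and rel: "\<And>f. f \<in> polys_over R \<Longrightarrow> poly f x = 0 \<Longrightarrow> poly (map_poly \<phi> f) t = 0"
  obtains \<psi> where "ring_hom_on (adjoin R x) \<psi>"
    "\<And>f. f \<in> polys_over R \<Longrightarrow> \<psi> (poly f x) = poly (map_poly \<phi> f) t"
    "\<And>a. a \<in> R \<Longrightarrow> \<psi> a = \<phi> a"
proof -
  note cl = polys_over_closed[OF R] and h = ring_hom_onD[OF R \<phi>]
  \<comment> \<open>An arbitrary representing polynomial is chosen. Two representatives differ by a
    relation of \<open>x\<close>, so \<open>rel\<close> makes the value independent of the
    choice.\<close>
  define \<psi> where "\<psi> y = poly (map_poly \<phi> (SOME f. f \<in> polys_over R \<and> poly f x = y)) t" for y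
  have \<psi>: "\<psi> (poly f x) = poly (map_poly \<phi> f) t" if f: "f \<in> polys_over R" for f
  proof -
    define g where "g = (SOME g. g \<in> polys_over R \<and> poly g x = poly f x)"
    have g: "g \<in> polys_over R" "poly g x = poly f x"
      using someI[of "\<lambda>g. g \<in> polys_over R \<and> poly g x = poly f x" f] f by (auto simp: g_def)
    have "poly (map_poly \<phi> (g - f)) t = 0"
      using g f by (intro rel cl) simp_all
    moreover have "map_poly \<phi> g = map_poly \<phi> (g - f) + map_poly \<phi> f"
      using map_poly_ring_hom_on(1)[OF R \<phi> cl(7)[OF g(1) f] f] by simp
    ultimately show ?thesis
      by (simp add: \<psi>_def g_def)
  qed
  have const: "\<psi> a = \<phi> a" if "a \<in> R" for a
    using \<psi>[OF cl(3)[OF that]] h by (simp add: map_poly_pCons)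
  have "ring_hom_on (adjoin R x) \<psi>"
    unfolding ring_hom_on_def
  proof (intro conjI ballI)
    show "\<psi> 1 = 1"
      using const[of 1] h unital_subringD[OF R] by simp
  next
    fix a b assume "a \<in> adjoin R x" "b \<in> adjoin R x"
    then obtain p q where p: "p \<in> polys_over R" "a = poly p x"
      and q: "q \<in> polys_over R" "b = poly q x"
      by (auto simp: adjoin_def)
    show "\<psi> (a + b) = \<psi> a + \<psi> b" "\<psi> (a * b) = \<psi> a * \<psi> b"
      using \<psi>[OF cl(6)[OF p(1) q(1)]] \<psi>[OF cl(8)[OF p(1) q(1)]] p q
      by (simp_all add: \<psi> map_poly_ring_hom_on[OF R \<phi>])
  qed
  then show ?thesis
    using that \<psi> const by blast
qed

section \<open>Extending homomorphisms across one generator\<close>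

text \<open>Over a finite field, one plus the product of all \<open>X - a\<close> takes the value 1
  everywhere and so has no root.\<close>

lemma alg_closed_infinite:
  assumes "alg_closed TYPE('k::field)"
  shows "infinite (UNIV :: 'k set)"
proof
  assume fin: "finite (UNIV :: 'k set)"
  define p :: "'k poly" where "p = (\<Prod>a\<in>UNIV. [:- a, 1:])"
  have deg: "degree p = card (UNIV :: 'k set)"
    unfolding p_def by (subst degree_prod_sum_eq) (auto simp: fin)
  have "card (UNIV :: 'k set) > 0"
    using fin by (simp add: card_gt_0_iff)
  then have "degree (p + 1) > 0"
    using deg by (subst degree_add_eq_left) auto
  then obtain x where "poly (p + 1) x = 0"
    using assms unfolding alg_closed_def by blast
  moreover have "poly p x = 0"
    unfolding p_def poly_prod using fin by (intro prod_zero) (auto intro!: bexI[of _ x])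
  ultimately show False
    by simp
qed

text \<open>Write \<open>b\<close> as \<open>q\<close> evaluated at \<open>x\<close> and take for
  \<open>a\<close> the leading coefficient of \<open>q\<close>. If \<open>\<phi>\<close> does not
  kill it, the image of \<open>q\<close> has finitely many roots; \<open>x\<close>, being subject to
  no relation, can be sent to any other element of the field.\<close>

lemma extend_hom_transcendental:
  fixes R :: "'a::comm_ring_1 set"
  assumes k: "infinite (UNIV :: 'k::field set)" and R: "unital_subring R"
    and tr: "\<And>p. p \<in> polys_over R \<Longrightarrow> poly p x = 0 \<Longrightarrow> p = 0"
    and b: "b \<in> adjoin R x" "b \<noteq> 0"
  shows "\<exists>a\<in>R. a \<noteq> 0 \<and> (\<forall>\<phi>::'a \<Rightarrow> 'k. ring_hom_on R \<phi> \<and> \<phi> a \<noteq> 0 \<longrightarrow>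
    (\<exists>\<psi>. ring_hom_on (adjoin R x) \<psi> \<and> (\<forall>r\<in>R. \<psi> r = \<phi> r) \<and> \<psi> b \<noteq> 0))"
proof -
  obtain q where q: "q \<in> polys_over R" "b = poly q x"
    using b by (auto simp: adjoin_def)
  have "q \<noteq> 0"
    using b q by auto
  then have lc: "lead_coeff q \<noteq> 0"
    by simp
  have "\<exists>\<psi>. ring_hom_on (adjoin R x) \<psi> \<and> (\<forall>r\<in>R. \<psi> r = \<phi> r) \<and> \<psi> b \<noteq> 0"
    if \<phi>: "ring_hom_on R \<phi>" "\<phi> (lead_coeff q) \<noteq> 0" for \<phi> :: "'a \<Rightarrow> 'k"
  proof -
    note h = ring_hom_onD[OF R \<phi>(1)]
    have "coeff (map_poly \<phi> q) (degree q) \<noteq> 0"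
      using \<phi>(2) by (simp add: coeff_map_poly h)
    then have "map_poly \<phi> q \<noteq> 0"
      by auto
    then have "finite {t. poly (map_poly \<phi> q) t = 0}"
      by (rule poly_roots_finite)
    then obtain t where t: "poly (map_poly \<phi> q) t \<noteq> 0"
      using k by (metis (mono_tags, lifting) UNIV_eq_I mem_Collect_eq)
    have rel: "poly (map_poly \<phi> f) t = 0" if "f \<in> polys_over R" "poly f x = 0" for f
      using tr[OF that] by simp
    obtain \<psi> where "ring_hom_on (adjoin R x) \<psi>"
      "\<And>f. f \<in> polys_over R \<Longrightarrow> \<psi> (poly f x) = poly (map_poly \<phi> f) t"
      "\<And>a. a \<in> R \<Longrightarrow> \<psi> a = \<phi> a"
      using ring_hom_on_adjoin[OF R \<phi>(1) rel] by blast
    then show ?thesis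
      using q t by (intro exI[of _ \<psi>]) auto
  qed
  then show ?thesis
    using lc polys_overD[OF q(1)] by blast
qed

text \<open>The witness is \<open>a * c\<close>. Here \<open>c\<close> is the leading coefficient of
  a relation \<open>p\<close> of least degree; if it survives under \<open>\<phi>\<close>, the image
  of \<open>p\<close> has a root to which \<open>x\<close> can be sent. The factor \<open>a\<close>
  is a nonzero multiple of \<open>b\<close> lying in \<open>R\<close>; if it survives, so does
  \<open>b\<close>.\<close>

lemma extend_hom_algebraic:
  fixes R :: "'a::comm_ring_1 set"
  assumes k: "alg_closed TYPE('k::field)" and R: "unital_subring R"
    and dom: "no_zero_divisors_on (adjoin R x)"
    and alg: "p0 \<in> polys_over R" "poly p0 x = 0" "p0 \<noteq> 0"
    and b: "b \<in> adjoin R x" "b \<noteq> 0"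
  shows "\<exists>a\<in>R. a \<noteq> 0 \<and> (\<forall>\<phi>::'a \<Rightarrow> 'k. ring_hom_on R \<phi> \<and> \<phi> a \<noteq> 0 \<longrightarrow>
    (\<exists>\<psi>. ring_hom_on (adjoin R x) \<psi> \<and> (\<forall>r\<in>R. \<psi> r = \<phi> r) \<and> \<psi> b \<noteq> 0))"
proof -
  note cl = polys_over_closed[OF R] and Rcl = unital_subringD[OF R]
  note S = unital_subring_adjoin[OF R, of x]
  note Scl = unital_subringD[OF S(1)]
  have evS: "poly f x \<in> adjoin R x" if "f \<in> polys_over R" for f
    using that by (auto simp: adjoin_def)
  have nz: "a * b \<noteq> 0" if "a \<in> adjoin R x" "b \<in> adjoin R x" "a \<noteq> 0" "b \<noteq> 0" for a b
    using dom that unfolding no_zero_divisors_on_def by blast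
  have nz_pow: "a ^ n \<noteq> 0" if "a \<in> adjoin R x" "a \<noteq> 0" for a n
    by (induction n) (simp_all add: nz Scl that)
  have lcR: "lead_coeff f \<in> R" if "f \<in> polys_over R" for f
    using that by (rule polys_overD)

  \<comment> \<open>\<open>p\<close> stands in for the minimal polynomial of \<open>x\<close> over
    the fraction field. It need not be monic, so \<open>c\<close> is carried along.\<close>
  define ann where "ann f \<longleftrightarrow> f \<in> polys_over R \<and> f \<noteq> 0 \<and> poly f x = 0" for f
  obtain p where p: "ann p" "\<And>f. ann f \<Longrightarrow> degree p \<le> degree f"
    using ex_has_least_nat[of ann p0 degree] alg by (auto simp: ann_def)
  have pR: "p \<in> polys_over R" and p0: "p \<noteq> 0" "poly p x = 0"
    using p(1) by (auto simp: ann_def)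
  define c where "c = lead_coeff p"
  have c: "c \<in> R" "c \<noteq> 0"
    using lcR[OF pR] p0 by (auto simp: c_def)
  have degp: "degree p > 0"
  proof (rule ccontr)
    assume "\<not> degree p > 0"
    then have "p = [:c:]"
      using degree_0_id[of p] by (simp add: c_def)
    then have "poly p x = c"
      by (metis mult_zero_right add_0_right poly_0 poly_pCons)
    then show False
      using p0 c by simp
  qed

  \<comment> \<open>A polynomial g of least degree with value in the ideal generated by b is constant, because
    p is irreducible over the fraction field of R; this gives a nonzero multiple of b in R.\<close>
  define J where "J f \<longleftrightarrow> f \<in> polys_over R \<and> f \<noteq> 0 \<and> (\<exists>s\<in>adjoin R x. poly f x = s * b)" for f
  have "J p"
    using pR p0 Scl by (auto simp: J_def intro!: bexI[of _ 0])
  then obtain g where g: "J g" "\<And>f. J f \<Longrightarrow> degree g \<le> degree f"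
    using ex_has_least_nat[of J p degree] by auto
  obtain s where gR: "g \<in> polys_over R" and g0: "g \<noteq> 0" and s: "s \<in> adjoin R x" "poly g x = s * b"
    using g(1) by (auto simp: J_def)
  obtain q where q: "q \<in> polys_over R" "b = poly q x"
    using b by (auto simp: adjoin_def)

  have "degree g < degree p"
  proof -
    \<comment> \<open>Reducing \<open>q\<close> modulo \<open>p\<close> leaves a remainder with
      value \<open>c ^ N * b\<close> at \<open>x\<close>, nonzero in a domain. It satisfies
      \<open>J\<close> and has smaller degree than \<open>p\<close>.\<close>
    obtain N h r where r: "h \<in> polys_over R" "r \<in> polys_over R"
      "smult (c ^ N) q = p * h + r" "r = 0 \<or> degree r < degree p"
      using pseudo_division_over[OF R q(1) pR p0(1)] unfolding c_def by metis
    have cN: "c ^ N \<in> adjoin R x"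
      using c S by (intro Scl) auto
    have ev: "poly r x = c ^ N * b"
      using arg_cong[OF r(3), of "\<lambda>f. poly f x"] p0 q by simp
    also have "\<dots> \<noteq> 0"
      using c S b by (intro nz nz_pow cN) auto
    finally have "r \<noteq> 0"
      by auto
    moreover from this have "J r"
      unfolding J_def using r ev cN by blast
    ultimately show ?thesis
      using g(2)[of r] r(4) by simp
  qed
  then have gx: "poly g x \<noteq> 0"
    using p(2)[of g] gR g0 by (auto simp: ann_def)

  have "degree g = 0"
  proof (rule ccontr)
    assume dg: "degree g \<noteq> 0"
    \<comment> \<open>Modulo \<open>g\<close>, the polynomial \<open>p\<close> leaves a remainder
      whose value is again a multiple of \<open>b\<close>, so minimality of \<open>g\<close> forces
      it to be zero. Then \<open>g\<close> divides a multiple of \<open>p\<close>, and the cofactor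
      \<open>h\<close> vanishes at \<open>x\<close>.\<close>
    obtain N h r where r: "h \<in> polys_over R" "r \<in> polys_over R"
      "smult (lead_coeff g ^ N) p = g * h + r" "r = 0 \<or> degree r < degree g"
      using pseudo_division_over[OF R pR gR g0] by metis
    have ev: "poly r x = (- s * poly h x) * b"
      using arg_cong[OF r(3), of "\<lambda>f. poly f x"] p0 s by (simp add: algebra_simps eq_neg_iff_add_eq_0)
    have "r = 0"
    proof (rule ccontr)
      assume "r \<noteq> 0"
      moreover have "- s * poly h x \<in> adjoin R x"
        using s r by (intro Scl evS) auto
      ultimately have "J r"
        unfolding J_def using r ev by blast
      then show False
        using g(2)[of r] r(4) \<open>r \<noteq> 0\<close> by simp
    qed
    then have gh: "smult (lead_coeff g ^ N) p = g * h"
      using r by simp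
    have "lead_coeff g ^ N * c \<noteq> 0"
      using S(2) lcR[OF gR] g0 c by (intro nz nz_pow Scl) auto
    then have top: "coeff (g * h) (degree p) \<noteq> 0"
      by (simp flip: gh add: c_def)
    then have "h \<noteq> 0"
      by auto
    have "poly g x * poly h x = 0"
      using arg_cong[OF gh, of "\<lambda>f. poly f x"] p0 by simp
    then have "poly h x = 0"
      using nz[OF evS evS, OF gR r(1)] gx by blast
    then have "degree p \<le> degree h"
      using \<open>h \<noteq> 0\<close> r by (intro p(2)) (simp add: ann_def)
    \<comment> \<open>The ambient ring may have zero divisors, so additivity of degrees is derived
      from the leading coefficients, which lie in the domain \<open>R[x]\<close>.\<close>
    moreover have "coeff (g * h) (degree g + degree h) \<noteq> 0"
      unfolding coeff_mult_degree_sum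
      using S(2) lcR[OF gR] lcR[OF r(1)] g0 \<open>h \<noteq> 0\<close> by (intro nz) auto
    then have "degree g + degree h \<le> degree p"
      unfolding gh[symmetric] by (metis le_degree degree_smult_le le_trans)
    ultimately show False
      using dg by simp
  qed
  define a where "a = lead_coeff g"
  have a: "a \<in> R" "a \<noteq> 0"
    using lcR[OF gR] g0 by (auto simp: a_def)
  have "g = [:a:]"
    using \<open>degree g = 0\<close> degree_0_id[of g] by (simp add: a_def)
  then have asb: "a = s * b"
    using s by (metis mult_zero_right add_0_right poly_0 poly_pCons)

  have "\<exists>\<psi>. ring_hom_on (adjoin R x) \<psi> \<and> (\<forall>r\<in>R. \<psi> r = \<phi> r) \<and> \<psi> b \<noteq> 0"
    if \<phi>: "ring_hom_on R \<phi>" "\<phi> (a * c) \<noteq> 0" for \<phi> :: "'a \<Rightarrow> 'k"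
  proof -
    note h = ring_hom_onD[OF R \<phi>(1)]
    have ac: "\<phi> a \<noteq> 0" "\<phi> c \<noteq> 0"
      using \<phi>(2) a c by (auto simp: h)
    have "coeff (map_poly \<phi> p) (degree p) \<noteq> 0"
      using ac by (simp add: coeff_map_poly h c_def)
    then have "degree (map_poly \<phi> p) > 0"
      using degp le_degree by fastforce
    then obtain t where t: "poly (map_poly \<phi> p) t = 0"
      using k unfolding alg_closed_def by blast
    \<comment> \<open>Pseudo-division by \<open>p\<close> leaves a remainder that kills
      \<open>x\<close> in smaller degree, hence zero. So \<open>\<phi> c ^ N\<close> times the value
      at \<open>t\<close> vanishes, and the power cancels.\<close>
    have rel: "poly (map_poly \<phi> f) t = 0" if f: "f \<in> polys_over R" "poly f x = 0" for f
    proof -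
      obtain N d r where r: "d \<in> polys_over R" "r \<in> polys_over R"
        "smult (c ^ N) f = p * d + r" "r = 0 \<or> degree r < degree p"
        using pseudo_division_over[OF R f(1) pR p0(1)] unfolding c_def by metis
      have "poly r x = 0"
        using arg_cong[OF r(3), of "\<lambda>f. poly f x"] p0 f by simp
      then have "r = 0"
        using p(2)[of r] r(2,4) unfolding ann_def by (metis not_less)
      then have "map_poly \<phi> (smult (c ^ N) f) = map_poly \<phi> (p * d)"
        using r by simp
      then have "smult (\<phi> c ^ N) (map_poly \<phi> f) = map_poly \<phi> p * map_poly \<phi> d"
        unfolding map_poly_ring_hom_on(2)[OF R \<phi>(1) pR r(1)]
          map_poly_ring_hom_on(3)[OF R \<phi>(1) f(1) f(1) Rcl(7)[OF c(1)]] h(5)[OF c(1)] .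
      from arg_cong[OF this, of "\<lambda>f. poly f t"] show ?thesis
        using t ac by simp
    qed
    obtain \<psi> where \<psi>: "ring_hom_on (adjoin R x) \<psi>" "\<And>a. a \<in> R \<Longrightarrow> \<psi> a = \<phi> a"
      using ring_hom_on_adjoin[OF R \<phi>(1) rel] by blast
    have "\<psi> s * \<psi> b = \<phi> a"
      using \<psi> asb a ring_hom_onD(4)[OF S(1) \<psi>(1) s(1) b(1)] by metis
    then have "\<psi> b \<noteq> 0"
      using ac by auto
    then show ?thesis
      using \<psi> by blast
  qed
  moreover have "a * c \<in> R" "a * c \<noteq> 0"
    using nz[of a c] Rcl(6)[of a c] a c S(2) by auto
  ultimately show ?thesis
    by blast
qed

lemma extend_hom_adjoin:
  fixes R :: "'a::comm_ring_1 set"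
  assumes "alg_closed TYPE('k::field)" "unital_subring R" "no_zero_divisors_on (adjoin R x)"
    and "b \<in> adjoin R x" "b \<noteq> 0"
  shows "\<exists>a\<in>R. a \<noteq> 0 \<and> (\<forall>\<phi>::'a \<Rightarrow> 'k. ring_hom_on R \<phi> \<and> \<phi> a \<noteq> 0 \<longrightarrow>
    (\<exists>\<psi>. ring_hom_on (adjoin R x) \<psi> \<and> (\<forall>r\<in>R. \<psi> r = \<phi> r) \<and> \<psi> b \<noteq> 0))"
  using extend_hom_transcendental[OF alg_closed_infinite, OF assms(1,2) _ assms(4,5)]
    extend_hom_algebraic[OF assms(1-3) _ _ _ assms(4,5)] by blast

section \<open>Extending homomorphisms across finitely many generators\<close>

lemma foldl_adjoin:
  assumes "unital_subring R"
  shows "unital_subring (foldl adjoin R xs)" "R \<union> set xs \<subseteq> foldl adjoin R xs"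
proof -
  have "unital_subring (foldl adjoin R xs) \<and> R \<union> set xs \<subseteq> foldl adjoin R xs"
    using assms
  proof (induction xs arbitrary: R)
    case (Cons x xs)
    then show ?case
      using unital_subring_adjoin[OF Cons.prems, of x] Cons.IH[of "adjoin R x"] by auto
  qed simp
  then show "unital_subring (foldl adjoin R xs)" "R \<union> set xs \<subseteq> foldl adjoin R xs"
    by auto
qed

lemma adjoin_least:
  assumes T: "unital_subring T" and "R \<subseteq> T" "x \<in> T"
  shows "adjoin R x \<subseteq> T"
  using assms(2,3) unfolding adjoin_def polys_over_def
  by (auto simp: poly_altdef intro!: unital_subring_sum[OF T] unital_subringD[OF T])

text \<open>Serves to place the iterated extension inside the coordinate ring, from which it
  inherits the absence of zero divisors.\<close>

lemma foldl_adjoin_least: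
  assumes "unital_subring T" "R \<subseteq> T" "set xs \<subseteq> T"
  shows "foldl adjoin R xs \<subseteq> T"
  using assms(2,3) by (induction xs arbitrary: R) (simp_all add: adjoin_least[OF assms(1)])

lemma no_zero_divisors_on_subset:
  "no_zero_divisors_on S \<Longrightarrow> R \<subseteq> S \<Longrightarrow> no_zero_divisors_on R"
  by (auto simp: no_zero_divisors_on_def)

text \<open>Induction on the generators with \<open>R\<close> varying: the tail supplies
  \<open>b'\<close> in \<open>R[x]\<close> whose survival ensures that of \<open>b\<close>, and the
  case of one generator then supplies \<open>a\<close> in \<open>R\<close> whose survival ensures
  that of \<open>b'\<close>.\<close>

lemma extend_hom_foldl_adjoin:
  fixes R :: "'a::comm_ring_1 set"
  assumes k: "alg_closed TYPE('k::field)" and R: "unital_subring R"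
    and dom: "no_zero_divisors_on (foldl adjoin R xs)"
    and b: "b \<in> foldl adjoin R xs" "b \<noteq> 0"
  shows "\<exists>a\<in>R. a \<noteq> 0 \<and> (\<forall>\<phi>::'a \<Rightarrow> 'k. ring_hom_on R \<phi> \<and> \<phi> a \<noteq> 0 \<longrightarrow>
    (\<exists>\<psi>. ring_hom_on (foldl adjoin R xs) \<psi> \<and> (\<forall>r\<in>R. \<psi> r = \<phi> r) \<and> \<psi> b \<noteq> 0))"
  using R dom b
proof (induction xs arbitrary: R)
  case Nil
  then show ?case
    by auto
next
  case (Cons x xs)
  let ?S = "adjoin R x" and ?T = "foldl adjoin R (x # xs)"
  note S = unital_subring_adjoin[OF Cons.prems(1), of x]
  have dom: "no_zero_divisors_on ?S"
    using foldl_adjoin(2)[OF S(1), of xs] Cons.prems(2) by (auto intro: no_zero_divisors_on_subset)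
  obtain b' where b': "b' \<in> ?S" "b' \<noteq> 0"
    "\<forall>\<phi>::'a \<Rightarrow> 'k. ring_hom_on ?S \<phi> \<and> \<phi> b' \<noteq> 0 \<longrightarrow>
      (\<exists>\<psi>. ring_hom_on ?T \<psi> \<and> (\<forall>r\<in>?S. \<psi> r = \<phi> r) \<and> \<psi> b \<noteq> 0)"
    using Cons.IH[OF S(1)] Cons.prems by auto
  obtain a where a: "a \<in> R" "a \<noteq> 0"
    "\<forall>\<phi>::'a \<Rightarrow> 'k. ring_hom_on R \<phi> \<and> \<phi> a \<noteq> 0 \<longrightarrow>
      (\<exists>\<psi>. ring_hom_on ?S \<psi> \<and> (\<forall>r\<in>R. \<psi> r = \<phi> r) \<and> \<psi> b' \<noteq> 0)"
    using extend_hom_adjoin[OF k Cons.prems(1) dom b'(1,2)] by blast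
  have "\<exists>\<psi>. ring_hom_on ?T \<psi> \<and> (\<forall>r\<in>R. \<psi> r = \<phi> r) \<and> \<psi> b \<noteq> 0"
    if \<phi>: "ring_hom_on R \<phi>" "\<phi> a \<noteq> 0" for \<phi> :: "'a \<Rightarrow> 'k"
  proof -
    obtain \<chi> where \<chi>: "ring_hom_on ?S \<chi>" "\<forall>r\<in>R. \<chi> r = \<phi> r" "\<chi> b' \<noteq> 0"
      using a(3) \<phi> by blast
    then obtain \<psi> where "ring_hom_on ?T \<psi>" "\<forall>r\<in>?S. \<psi> r = \<chi> r" "\<psi> b \<noteq> 0"
      using b'(3) by blast
    then show ?thesis
      using \<chi> S(2) by (intro exI[of _ \<psi>]) (auto simp: subset_iff)
  qed
  then show ?case
    using a by blast
qed

section \<open>Coordinate rings of irreducible varieties\<close>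

text \<open>The zero sets of \<open>p\<close> and \<open>q\<close> cover \<open>X\<close>, so
  irreducibility puts \<open>X\<close> inside one of them.\<close>

lemma irreducible_variety_mult_eq_0:
  assumes "irreducible_variety X" "p \<in> polyfun" "q \<in> polyfun" "\<forall>x\<in>X. p x * q x = (0::'k::idom)"
  shows "(\<forall>x\<in>X. p x = 0) \<or> (\<forall>x\<in>X. q x = 0)"
proof -
  have "zariski_closed {x. p x = 0}" "zariski_closed {x. q x = 0}"
    unfolding zariski_closed_def
    by (rule exI[of _ "{p}"], simp add: assms(2)) (rule exI[of _ "{q}"], simp add: assms(3))
  moreover have "X \<subseteq> {x. p x = 0} \<union> {x. q x = 0}"
    using assms(4) by auto
  ultimately have "X \<subseteq> {x. p x = 0} \<or> X \<subseteq> {x. q x = 0}"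
    using assms(1) unfolding irreducible_variety_def by blast
  then show ?thesis
    by auto
qed

text \<open>Evaluation at \<open>y\<close> is a homomorphism on \<open>A\<close>. An extension of it
  to the coordinate ring is evaluation at a point \<open>x\<close> of \<open>X\<close>; agreement on
  \<open>A\<close> puts \<open>x\<close> in the fibre of \<open>y\<close>, and not killing
  \<open>g\<close> means that \<open>g x\<close> is nonzero.\<close>

lemma general_fibre_meets_principal_open:
  fixes X :: "('n::finite \<Rightarrow> 'k::field) set"
  assumes k: "alg_closed TYPE('k)" and X: "irreducible_variety X"
    and A: "A \<subseteq> polyfun" "\<And>c. (\<lambda>x. c) \<in> A"
      "\<And>p q. p \<in> A \<Longrightarrow> q \<in> A \<Longrightarrow> (\<lambda>x. p x + q x) \<in> A"
      "\<And>p q. p \<in> A \<Longrightarrow> q \<in> A \<Longrightarrow> (\<lambda>x. p x * q x) \<in> A"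
    and g: "g \<in> polyfun" "x0 \<in> X" "g x0 \<noteq> 0"
  obtains a where "a \<in> A" "\<exists>x\<in>X. a x \<noteq> 0"
    "\<And>y. y \<in> X \<Longrightarrow> a y \<noteq> 0 \<Longrightarrow> \<exists>x\<in>X. g x \<noteq> 0 \<and> (\<forall>p\<in>A. p x = p y)"
proof -
  \<comment> \<open>Composing polynomials with a retraction onto X realises the coordinate ring as a ring of
    functions; restriction to X with junk value 0 outside would not preserve the unit.\<close>
  define \<rho> where "\<rho> x = (if x \<in> X then x else x0)" for x
  have \<rho>: "\<rho> x \<in> X" "x \<in> X \<Longrightarrow> \<rho> x = x" for x
    using g by (auto simp: \<rho>_def)
  define pull :: "(('n \<Rightarrow> 'k) \<Rightarrow> 'k) \<Rightarrow> ('n \<Rightarrow> 'k) \<Rightarrow> 'k" where "pull p = (\<lambda>x. p (\<rho> x))" for p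
  \<comment> \<open>Negation is written as multiplication by the constant -1, so that closure under
    constants and products yields it.\<close>
  have pull_ops: "pull (\<lambda>x. p x + q x) = pull p + pull q" "pull (\<lambda>x. p x * q x) = pull p * pull q"
    "pull (\<lambda>x. 1) = 1" "pull (\<lambda>x. - 1 * p x) = - pull p" for p q
    by (auto simp: pull_def)
  have subring_pull: "unital_subring (pull ` B)"
    if "\<And>c. (\<lambda>x. c) \<in> B" "\<And>p q. p \<in> B \<Longrightarrow> q \<in> B \<Longrightarrow> (\<lambda>x. p x + q x) \<in> B"
      "\<And>p q. p \<in> B \<Longrightarrow> q \<in> B \<Longrightarrow> (\<lambda>x. p x * q x) \<in> B" for B
    unfolding unital_subring_def
    using that(2,3) that(1)[of 1] that(3)[OF that(1)[of "- 1"]]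
    by (auto simp flip: pull_ops)
  note polyfun.intros [intro]
  define R where "R = pull ` A"
  have R: "unital_subring R" and T: "unital_subring (pull ` polyfun)"
    unfolding R_def by (intro subring_pull A; assumption) (intro subring_pull; blast)
  obtain js :: "'n list" where js: "set js = UNIV"
    using finite_list[of "UNIV :: 'n set"] by auto
  \<comment> \<open>Adjoining the finitely many coordinate functions to \<open>R\<close> already
    produces every polynomial function on \<open>X\<close>.\<close>
  define S where "S = foldl adjoin R (map (\<lambda>i. pull (\<lambda>x. x i)) js)"
  have S: "unital_subring S" "R \<subseteq> S" "pull (\<lambda>x. x i) \<in> S" for i
    using foldl_adjoin[OF R, of "map (\<lambda>i. pull (\<lambda>x. x i)) js"] js by (auto simp: S_def)
  note Scl = unital_subringD[OF S(1)]
  have pull_S: "pull p \<in> S" if "p \<in> polyfun" for p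
    using that
  proof induction
    case (pf_const c)
    then show ?case
      using S(2) A(2) by (auto simp: R_def)
  next
    case (pf_add p q)
    then show ?case
      using Scl(4) by (simp only: pull_ops)
  next
    case (pf_mult p q)
    then show ?case
      using Scl(6) by (simp only: pull_ops)
  qed (rule S(3))
  have "S \<subseteq> pull ` polyfun"
    unfolding S_def R_def using A(1) by (intro foldl_adjoin_least T) auto
  moreover have "no_zero_divisors_on (pull ` polyfun)"
    unfolding no_zero_divisors_on_def
  proof (intro ballI impI)
    fix a b assume "a \<in> pull ` polyfun" "b \<in> pull ` polyfun" "a * b = 0"
    then obtain p q where p: "p \<in> polyfun" "a = pull p" and q: "q \<in> polyfun" "b = pull q"
      by blast
    have "p x * q x = 0" if "x \<in> X" for x
      using fun_cong[OF \<open>a * b = 0\<close>, of x] p q \<rho>(2)[OF that] by (simp add: pull_def)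
    then have "(\<forall>x\<in>X. p x = 0) \<or> (\<forall>x\<in>X. q x = 0)"
      using irreducible_variety_mult_eq_0[OF X p(1) q(1)] by blast
    then show "a = 0 \<or> b = 0"
      using p q \<rho>(1) by (auto simp: pull_def fun_eq_iff)
  qed
  ultimately have dom: "no_zero_divisors_on S"
    by (metis no_zero_divisors_on_subset)
  have "pull g x0 \<noteq> 0"
    using g \<rho> by (simp add: pull_def)
  then have g0: "pull g \<noteq> 0"
    by auto
  obtain b where b: "b \<in> R" "b \<noteq> 0" and ext: "\<And>\<phi> :: (('n \<Rightarrow> 'k) \<Rightarrow> 'k) \<Rightarrow> 'k.
      ring_hom_on R \<phi> \<Longrightarrow> \<phi> b \<noteq> 0 \<Longrightarrow>
      \<exists>\<psi>. ring_hom_on S \<psi> \<and> (\<forall>r\<in>R. \<psi> r = \<phi> r) \<and> \<psi> (pull g) \<noteq> 0"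
    using extend_hom_foldl_adjoin[OF k R dom[unfolded S_def] pull_S[OF g(1), unfolded S_def] g0]
    unfolding S_def by blast
  obtain a where a: "a \<in> A" "b = pull a"
    using b by (auto simp: R_def)
  show ?thesis
  proof (rule that[OF a(1)])
    show "\<exists>x\<in>X. a x \<noteq> 0"
      using b a \<rho>(1) by (auto simp: pull_def fun_eq_iff)
  next
    fix y assume y: "y \<in> X" "a y \<noteq> 0"
    have "ring_hom_on R (\<lambda>f. f y)"
      by (auto simp: ring_hom_on_def)
    moreover have "b y \<noteq> 0"
      using a y \<rho> by (simp add: pull_def)
    ultimately obtain \<psi> where \<psi>: "ring_hom_on S \<psi>" "\<And>r. r \<in> R \<Longrightarrow> \<psi> r = r y"
      "\<psi> (pull g) \<noteq> 0"
      using ext by blast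
    define x where "x i = \<psi> (pull (\<lambda>x. x i))" for i
    have eval: "\<psi> (pull p) = p x" if "p \<in> polyfun" for p
      using that
    proof induction
      \<comment> \<open>\<open>\<psi>\<close> is only a ring homomorphism; it fixes constants
        because they lie in \<open>R\<close>, where it is evaluation at \<open>y\<close>.\<close>
      case (pf_const c)
      have "\<psi> (pull (\<lambda>x. c)) = pull (\<lambda>x. c) y"
        using A(2) by (intro \<psi>(2)) (auto simp: R_def)
      then show ?case
        by (simp add: pull_def)
    next
      case (pf_add p q)
      then show ?case
        by (simp only: pull_ops pull_S ring_hom_onD(3)[OF S(1) \<psi>(1)])
    next
      case (pf_mult p q)
      then show ?case
        by (simp only: pull_ops pull_S ring_hom_onD(4)[OF S(1) \<psi>(1)])
    qed (simp add: x_def)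
    \<comment> \<open>The equations defining \<open>X\<close> become zero in the coordinate ring, so
      \<open>\<psi>\<close> sends them to zero, which says that they hold at
      \<open>x\<close>.\<close>
    have "x \<in> X"
    proof -
      obtain F where F: "F \<subseteq> polyfun" "X = {x. \<forall>f\<in>F. f x = 0}"
        using X unfolding irreducible_variety_def zariski_closed_def by blast
      have "f x = 0" if "f \<in> F" for f
      proof -
        have "f z = 0" if "z \<in> X" for z
          using that \<open>f \<in> F\<close> F(2) by blast
        then have "pull f = 0"
          using \<rho>(1) by (auto simp: pull_def fun_eq_iff)
        then show ?thesis
          using eval[of f] F(1) that ring_hom_onD(2)[OF S(1) \<psi>(1)] by auto
      qed
      then show ?thesis
        using F(2) by blast
    qed
    moreover have "g x \<noteq> 0"
      using \<psi>(3) eval[OF g(1)] by simp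
    moreover have "p x = p y" if "p \<in> A" for p
    proof -
      have "p x = \<psi> (pull p)"
        using eval that A(1) by auto
      also have "\<dots> = p y"
        using \<psi>(2)[of "pull p"] that y \<rho> by (simp add: R_def pull_def)
      finally show ?thesis .
    qed
    ultimately show "\<exists>x\<in>X. g x \<noteq> 0 \<and> (\<forall>p\<in>A. p x = p y)"
      by blast
  qed
qed

section \<open>Orbits and observability\<close>

lemma subset_zclosure: "S \<subseteq> zclosure S"
  by (auto simp: zclosure_def)

text \<open>If \<open>y\<close> is the translate of \<open>w\<close> by \<open>h\<close>, acting on
  \<open>y\<close> by the inverse of \<open>h\<close> brings \<open>w\<close> into \<open>Y\<close>,
  and the rest of the orbit follows.\<close>

lemma orbit_subset_stable:
  assumes G: "group G" and act: "regular_action G X act"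
    and Y: "\<forall>g\<in>carrier G. \<forall>y\<in>Y. act g y \<in> Y"
    and "w \<in> X" "y \<in> orbit G act w" "y \<in> Y"
  shows "orbit G act w \<subseteq> Y"
proof -
  interpret group G
    by (rule G)
  have mult: "act (g \<otimes>\<^bsub>G\<^esub> h) w = act g (act h w)" if "g \<in> carrier G" "h \<in> carrier G" for g h
    using act \<open>w \<in> X\<close> that by (auto simp: regular_action_def)
  obtain h where h: "h \<in> carrier G" "y = act h w"
    using assms(5) by (auto simp: orbit_def)
  have "act (inv\<^bsub>G\<^esub> h) y = act \<one>\<^bsub>G\<^esub> w"
    using h mult[of "inv\<^bsub>G\<^esub> h" h] by simp
  also have "\<dots> = w"
    using act \<open>w \<in> X\<close> by (simp add: regular_action_def)
  finally have "w \<in> Y"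
    using Y h \<open>y \<in> Y\<close> by (metis inv_closed)
  then show ?thesis
    using Y by (auto simp: orbit_def)
qed

theorem theorem6p4:
  fixes G :: "('m::finite \<Rightarrow> 'k::field) monoid"
    and X :: "('n::finite \<Rightarrow> 'k) set"
    and act :: "('m \<Rightarrow> 'k) \<Rightarrow> ('n \<Rightarrow> 'k) \<Rightarrow> ('n \<Rightarrow> 'k)"
    and fs :: "(('n \<Rightarrow> 'k) \<Rightarrow> 'k) list"
  assumes "alg_closed TYPE('k)"
    and "affine_alg_group G"
    and "irreducible_variety X"
    and "regular_action G X act"
    and "generates_invariants G X act fs"
    and "\<forall>z\<in>aff_quotient X fs. \<exists>x\<in>X. {y\<in>X. gen_map fs y = z} = orbit G act x"
  shows "observable_action G X act"
  unfolding observable_action_def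
proof (intro allI impI, elim conjE)
  fix Y assume Y: "zariski_closed Y" "Y \<subseteq> X" "Y \<noteq> X" "\<forall>g\<in>carrier G. \<forall>y\<in>Y. act g y \<in> Y"
  have G: "group G"
    using assms(2) by (simp add: affine_alg_group_def)
  then interpret group G .
  have act_X: "act (inv\<^bsub>G\<^esub> h) x \<in> X" if "h \<in> carrier G" "x \<in> X" for h x
    using assms(4) that by (auto simp: regular_action_def)
  obtain x0 where x0: "x0 \<in> X" "x0 \<notin> Y"
    using Y by blast
  \<comment> \<open>\<open>g\<close> is one of the equations defining \<open>Y\<close>, chosen to
    fail at \<open>x0\<close>.\<close>
  obtain g where g: "g \<in> polyfun" "g x0 \<noteq> 0" "\<And>y. y \<in> Y \<Longrightarrow> g y = 0"
    using Y(1) x0(2) unfolding zariski_closed_def by blast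
  \<comment> \<open>An invariant function is constrained on \<open>X\<close> only. \<open>A\<close>
    keeps those that are polynomial on the whole space; each invariant agrees on \<open>X\<close>
    with a member of \<open>A\<close>.\<close>
  define A where "A = {p \<in> polyfun. invariant_fun G X act p}"
  have inv: "p \<in> A \<longleftrightarrow> p \<in> polyfun \<and> (\<forall>h\<in>carrier G. \<forall>x\<in>X. p (act (inv\<^bsub>G\<^esub> h) x) = p x)" for p
    by (auto simp: A_def invariant_fun_def regular_on_def)
  obtain a where a: "a \<in> A" "\<exists>x\<in>X. a x \<noteq> 0"
    "\<And>y. y \<in> X \<Longrightarrow> a y \<noteq> 0 \<Longrightarrow> \<exists>x\<in>X. g x \<noteq> 0 \<and> (\<forall>p\<in>A. p x = p y)"
    by (rule general_fibre_meets_principal_open[OF assms(1,3) _ _ _ _ g(1) x0(1) g(2), of A])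
      (auto simp: inv intro: polyfun.intros)
  have "a y = 0" if y: "y \<in> Y" for y
  proof (rule ccontr)
    assume "a y \<noteq> 0"
    then obtain x where x: "x \<in> X" "g x \<noteq> 0" "\<And>p. p \<in> A \<Longrightarrow> p x = p y"
      using a(3)[of y] y Y(2) by blast
    \<comment> \<open>A generator need not lie in \<open>A\<close> itself, so the equality is
      carried over from a polynomial representative.\<close>
    have "f x = f y" if "f \<in> set fs" for f
    proof -
      have f: "invariant_fun G X act f"
        using assms(5) that by (simp add: generates_invariants_def)
      then obtain p where p: "p \<in> polyfun" "\<And>z. z \<in> X \<Longrightarrow> f z = p z"
        by (auto simp: invariant_fun_def regular_on_def)
      have "p \<in> A"
        using f p act_X by (simp add: inv invariant_fun_def)
      then show ?thesis
        using x p y Y(2) by auto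
    qed
    then have eq: "gen_map fs x = gen_map fs y"
      by (auto simp: gen_map_def fun_eq_iff)
    \<comment> \<open>The image of \<open>y\<close> is a point of the quotient, so the hypothesis on
      fibres makes the common fibre of \<open>x\<close> and \<open>y\<close> a single orbit.\<close>
    have "gen_map fs y \<in> aff_quotient X fs"
      using subset_zclosure y Y(2) unfolding aff_quotient_def by blast
    then obtain w where w: "w \<in> X" "{u \<in> X. gen_map fs u = gen_map fs y} = orbit G act w"
      using assms(6) by blast
    have "x \<in> orbit G act w" "y \<in> orbit G act w"
      using w(2) eq x(1) y Y(2) by blast+
    then have "x \<in> Y"
      using orbit_subset_stable[OF G assms(4) Y(4) w(1) _ y] by blast
    then show False
      using g(3) x(2) by blast
  qed
  then show "\<exists>f. invariant_fun G X act f \<and> (\<exists>x\<in>X. f x \<noteq> 0) \<and> (\<forall>y\<in>Y. f y = 0)"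
    using a(1,2) by (auto simp: A_def)
qed

end
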